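(* Let $r,s$ be positive integers and let $\boldsymbol{\alpha}=(\alpha_1,\dots,\alpha_r)$, $\boldsymbol{\beta}=(\beta_1,\dots,\beta_s)$ with all $\alpha_i,\beta_j\in\mathbb{Q}\setminus\mathbb{Z}_{\le 0}$. Let $p$ be a prime with $p>\max\{M_{\boldsymbol{\alpha},\boldsymbol{\beta}},\,3s\,d_{\boldsymbol{\alpha},\boldsymbol{\beta}}\}$, and let $a$ be the integer with $1\le a\le d_{\boldsymbol{\alpha},\boldsymbol{\beta}}$ and $ap\equiv 1\pmod{d_{\boldsymbol{\alpha},\boldsymbol{\beta}}}$. Then: (i) If $r<s$, then $F_{\boldsymbol{\alpha},\boldsymbol{\beta}}(z)\notin\mathbb{Z}_p[[z]]$. (ii) If $r>s$, then $F_{\boldsymbol{\alpha},\boldsymbol{\beta}}(z)\in\mathbb{Z}_p[[z]]$ if and only if $\delta_{\boldsymbol{\alpha},\boldsymbol{\beta}}(x,a)\ge 0$ for all $x\in\mathbb{R}$. (iii) If $r=s$, then $F_{\boldsymbol{\alpha},\boldsymbol{\beta}}(z)\in\mathbb{Z}_p[[z]]$ if and only if both of the following hold: $\sum_{l=1}^{h}\delta_{\boldsymbol{\alpha},\boldsymbol{\beta}}(a^l\beta_k,a^l)\ge 0$ for all $h\in\{1,\dots,\mathrm{ord}(a)\}$ and all $k\in\{1,\dots,s\}$; and $\delta_{\boldsymbol{\alpha},\boldsymbol{\beta}}\big(a^l(\tfrac{e}{d_{\boldsymbol{\alpha},\boldsymbol{\beta}}}+m_{\boldsymbol{\alpha},\boldsymbol{\beta}}),a^l\big)\ge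 0$ for all $l\in\{1,\dots,\mathrm{ord}(a)\}$ and all $e\in\{1,\dots,d_{\boldsymbol{\alpha},\boldsymbol{\beta}}\}$, where $\mathrm{ord}(a)$ is the multiplicative order of $a$ modulo $d_{\boldsymbol{\alpha},\boldsymbol{\beta}}$.
   Context: Pochhammer symbol: $(x)_0=1$, $(x)_n=x(x+1)\cdots(x+n-1)$ for $n\ge1$. The hypergeometric series is $F_{\boldsymbol{\alpha},\boldsymbol{\beta}}(z)=\sum_{n\ge0}\frac{(\alpha_1)_n\cdots(\alpha_r)_n}{(\beta_1)_n\cdots(\beta_s)_n}z^n$. For $x\in\mathbb{R}$, $\langle x\rangle$ is the unique number in $(0,1]$ with $x-\langle x\rangle\in\mathbb{Z}$. The total order $\preccurlyeq$ on $\mathbb{R}$: $x\preccurlyeq y$ iff either $\langle x\rangle<\langle y\rangle$, or $\langle x\rangle=\langle y\rangle$ and $x\ge y$. $d_{\boldsymbol{\alpha},\boldsymbol{\beta}}$ is the least common multiple of the exact (reduced) denominators of all $\alpha_i,\beta_j$. For a positive integer $a$ coprime to $d_{\boldsymbol{\alpha},\boldsymbol{\beta}}$ and $x\in\mathbb{R}$, $\delta_{\boldsymbol{\alpha},\boldsymbol{\beta}}(x,a)=\#\{1\le i\le r: a\alpha_i\preccurlyeq x\}-\#\{1\le j\le s: a\beta_j\preccurlyeq x\}$. Further $M_{\boldsymbol{\alpha},\boldsymbol{\beta}}=d_{\boldsymbol{\alpha},\boldsymbol{\beta}}\big(2+2\max_{i,j}\{|\alpha_i|,|\beta_j|\}\big)$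 and $m_{\boldsymbol{\alpha},\boldsymbol{\beta}}=\min_{i,j}\{\alpha_i-\langle\alpha_i\rangle,\ \beta_j-\langle\beta_j\rangle\}$. *)

theory Defs
  imports
    "HOL-Number_Theory.Number_Theory"
    "HOL-Computational_Algebra.Formal_Power_Series"
    "HOL-Library.Nonpos_Ints"
begin

definition hypergeo_series :: "rat list \<Rightarrow> rat list \<Rightarrow> rat fps" where
  "hypergeo_series \<alpha> \<beta> = Abs_fps (\<lambda>n.
     (\<Prod>i<length \<alpha>. pochhammer (\<alpha> ! i) n) / (\<Prod>j<length \<beta>. pochhammer (\<beta> ! j) n))"

text \<open>
  The $p$-adic valuation and absolute value on the rationals.  The value of
  \<open>padic_val\<close> at \<open>0\<close> is irrelevant, as \<open>padic_abs\<close> treats \<open>0\<close> separately.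
\<close>

definition padic_val :: "nat \<Rightarrow> rat \<Rightarrow> int" where
  "padic_val p x = int (multiplicity (int p) (fst (quotient_of x)))
                 - int (multiplicity (int p) (snd (quotient_of x)))"

definition padic_abs :: "nat \<Rightarrow> rat \<Rightarrow> real" where
  "padic_abs p x = (if x = 0 then 0 else real p powi (- padic_val p x))"

text \<open>
  The ring of $p$-adic integers is the closed unit ball of the completion of the rationals with
  respect to \<open>padic_abs p\<close>.  All power series considered here have rational coefficients, so only
  its rational elements are needed.
\<close>

definition padic_int_rats :: "nat \<Rightarrow> rat set" where
  "padic_int_rats p = {x. padic_abs p x \<le> 1}"

definition padic_int_fps :: "nat \<Rightarrow> rat fps set" where
  "padic_int_fps p = {F. \<forall>n. fps_nth F n \<in> padic_int_rats p}"

text \<open>Unlike \<open>frac\<close>, the following takes values in the interval $(0,1]$.\<close>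

definition frac1 :: "real \<Rightarrow> real" where
  "frac1 x = (THE y. 0 < y \<and> y \<le> 1 \<and> x - y \<in> \<int>)"

lemma frac1_unique: "\<exists>!y. 0 < y \<and> y \<le> 1 \<and> (x::real) - y \<in> \<int>"
proof (rule ex1I[of _ "x - of_int (\<lceil>x\<rceil> - 1)"])
  show "0 < x - of_int (\<lceil>x\<rceil> - 1) \<and> x - of_int (\<lceil>x\<rceil> - 1) \<le> 1 \<and>
        x - (x - of_int (\<lceil>x\<rceil> - 1)) \<in> \<int>"
    by (simp add: algebra_simps) linarith
next
  fix y :: real
  assume y: "0 < y \<and> y \<le> 1 \<and> x - y \<in> \<int>"
  then obtain k where k: "x - y = of_int k" by (auto elim: Ints_cases)
  with y have "\<lceil>x\<rceil> = k + 1" by (intro ceiling_unique) auto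
  with k show "y = x - of_int (\<lceil>x\<rceil> - 1)" by simp
qed

definition christol_le :: "real \<Rightarrow> real \<Rightarrow> bool"  (infix \<open>\<preceq>\<close> 50) where
  "x \<preceq> y \<longleftrightarrow> frac1 x < frac1 y \<or> (frac1 x = frac1 y \<and> x \<ge> y)"

definition hg_denom :: "rat list \<Rightarrow> rat list \<Rightarrow> nat" where
  "hg_denom \<alpha> \<beta> = Lcm ((\<lambda>x. nat (snd (quotient_of x))) ` (set \<alpha> \<union> set \<beta>))"

definition hg_delta :: "rat list \<Rightarrow> rat list \<Rightarrow> real \<Rightarrow> nat \<Rightarrow> int" where
  "hg_delta \<alpha> \<beta> x a =
     int (card {i. i < length \<alpha> \<and> real a * real_of_rat (\<alpha> ! i) \<preceq> x})
   - int (card {j. j < length \<beta> \<and> real a * real_of_rat (\<beta> ! j) \<preceq> x})"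

definition hg_M :: "rat list \<Rightarrow> rat list \<Rightarrow> real" where
  "hg_M \<alpha> \<beta> = real (hg_denom \<alpha> \<beta>) *
     (2 + 2 * Max ((\<lambda>x. \<bar>real_of_rat x\<bar>) ` (set \<alpha> \<union> set \<beta>)))"

definition hg_m :: "rat list \<Rightarrow> rat list \<Rightarrow> real" where
  "hg_m \<alpha> \<beta> = Min ((\<lambda>x. real_of_rat x - frac1 (real_of_rat x)) ` (set \<alpha> \<union> set \<beta>))"

end

theory Submission
  imports Defs
begin

text \<open>
  For a parameter \<open>x\<close> let \<open>\<rho> l x\<close> be the residue \<open>k\<close> modulo \<open>p ^ l\<close> with \<open>x + k \<equiv> 0\<close>.  Since \<open>p\<close> is
  large, \<open>\<rho> l x = p ^ l * frac1 (a ^ l * x) - x\<close>, so that \<open>\<rho> l x \<le> \<rho> l y\<close> is the same as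
  \<open>a ^ l * x \<preceq> a ^ l * y\<close>.  Counting the factors divisible by \<open>p ^ l\<close> for each \<open>l\<close>, the valuation of
  the \<open>n\<close>-th coefficient is the sum over \<open>l\<close> of \<open>(r - s) * (n div p ^ l)\<close> and
  \<open>D l (n mod p ^ l)\<close>, where \<open>D l m\<close> counts the \<open>\<alpha>\<^sub>i\<close> minus the \<open>\<beta>\<^sub>j\<close> with \<open>\<rho> l < m\<close>.
  If \<open>r < s\<close>, take \<open>n = p\<close>.  If \<open>r > s\<close>, the indices \<open>n \<le> p\<close> give the values of \<open>\<delta>(_, a)\<close>, and
  for the converse \<open>n div p\<close> outweighs all levels \<open>l \<ge> 2\<close>.  If \<open>r = s\<close>, the first condition is read
  off at \<open>n = \<rho> h \<beta>\<^sub>k + 1\<close> and the second at multiples \<open>n\<close> of \<open>p ^ (l - 1)\<close> lying between two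
  clusters of residues \<open>\<rho> l x\<close>.
\<close>

section \<open>Representatives modulo 1 in the interval (0, 1]\<close>

lemma frac1_props: "0 < frac1 x" "frac1 x \<le> 1" "x - frac1 x \<in> \<int>"
  using theI'[OF frac1_unique[of x]] unfolding frac1_def by auto

lemma frac1_eqI: "0 < y \<Longrightarrow> y \<le> 1 \<Longrightarrow> x - y \<in> \<int> \<Longrightarrow> frac1 x = y"
  using frac1_unique[of x] frac1_props[of x] by auto

lemma frac1_cong: "x - y \<in> \<int> \<Longrightarrow> frac1 x = frac1 y"
  using Ints_add[OF _ frac1_props(3)[of y], of "x - y"] frac1_props(1,2)[of y]
  by (intro frac1_eqI) auto

lemma frac1_eq_imp_diff_Ints: "frac1 x = frac1 y \<Longrightarrow> x - y \<in> \<int>"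
  using Ints_diff[OF frac1_props(3)[of x] frac1_props(3)[of y]] by simp

lemma mult_frac1_Ints:
  assumes "real d * x \<in> \<int>"
  shows "real d * frac1 x \<in> \<int>"
proof -
  have "real d * frac1 x = real d * x - real d * (x - frac1 x)"
    by (simp add: algebra_simps)
  then show ?thesis
    using assms frac1_props(3)[of x] by (metis Ints_diff Ints_mult Ints_of_nat)
qed

subsection \<open>The $p$-adic valuation\<close>

text \<open>\<open>padic_val\<close> reads off the reduced fraction; cross-multiplying with it shows
  that every other representation, whatever its signs, gives the same difference.\<close>

lemma padic_val_fraction:
  assumes "prime p" "m \<noteq> 0" "n \<noteq> 0"
  shows "padic_val p (of_int m / of_int n) =
           int (multiplicity (int p) m) - int (multiplicity (int p) n)"
proof -
  let ?x = "of_int m / of_int n :: rat"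
  obtain u v where uv: "quotient_of ?x = (u, v)" by fastforce
  have v: "v > 0" and x: "?x = of_int u / of_int v"
    using quotient_of_denom_pos[OF uv] quotient_of_div[OF uv] by auto
  have "(of_int (u * n) :: rat) = of_int (m * v)"
    using x v assms by (simp add: field_simps)
  then have eq: "u * n = m * v" by linarith
  with assms v have "u \<noteq> 0" by auto
  have "prime_elem (int p)" using assms(1) by auto
  then have "multiplicity (int p) u + multiplicity (int p) n =
             multiplicity (int p) m + multiplicity (int p) v"
    using eq \<open>u \<noteq> 0\<close> v assms(2,3)
    using prime_elem_multiplicity_mult_distrib[of "int p" u n]
      prime_elem_multiplicity_mult_distrib[of "int p" m v] by simp
  then show ?thesis
    unfolding padic_val_def uv by simp
qed

lemma rat_fraction:
  fixes x :: rat
  obtains m n where "x = of_int m / of_int n" "n \<noteq> 0"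
proof -
  obtain m n where "quotient_of x = (m, n)" by fastforce
  then show thesis
    using that[of m n] quotient_of_div[of x m n] quotient_of_denom_pos[of x m n] by simp
qed

lemma padic_val_mult:
  assumes "prime p" "x \<noteq> 0" "y \<noteq> 0"
  shows "padic_val p (x * y) = padic_val p x + padic_val p y"
proof -
  obtain m n where x: "x = of_int m / of_int n" "n \<noteq> 0"
    by (rule rat_fraction)
  obtain m' n' where y: "y = of_int m' / of_int n'" "n' \<noteq> 0"
    by (rule rat_fraction)
  have nz: "m \<noteq> 0" "m' \<noteq> 0" using assms x y by auto
  have "x * y = of_int (m * m') / of_int (n * n')" using x y by simp
  moreover have "prime_elem (int p)" using assms(1) by auto
  ultimately show ?thesis
    using nz x(2) y(2) padic_val_fraction[OF assms(1), of "m * m'" "n * n'"]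
      padic_val_fraction[OF assms(1), of m n] padic_val_fraction[OF assms(1), of m' n']
    unfolding x(1) y(1) by (simp add: prime_elem_multiplicity_mult_distrib)
qed

lemma padic_val_1 [simp]: "padic_val p 1 = 0"
  by (simp add: padic_val_def)

lemma padic_val_divide:
  assumes "prime p" "x \<noteq> 0" "y \<noteq> 0"
  shows "padic_val p (x / y) = padic_val p x - padic_val p y"
  using padic_val_mult[of p "x / y" y] assms by simp

lemma padic_val_prod:
  assumes "prime p" "finite A" "\<And>i. i \<in> A \<Longrightarrow> f i \<noteq> 0"
  shows "padic_val p (\<Prod>i\<in>A. f i) = (\<Sum>i\<in>A. padic_val p (f i))"
  using assms(2,3) by (induction A rule: finite_induct) (auto simp: padic_val_mult[OF assms(1)])

lemma padic_int_rats_iff: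
  assumes "prime p" "x \<noteq> 0"
  shows "x \<in> padic_int_rats p \<longleftrightarrow> padic_val p x \<ge> 0"
proof -
  have p: "real p > 1" using prime_gt_1_nat[OF assms(1)] by simp
  have "real p powi (- v) \<le> 1 \<longleftrightarrow> v \<ge> 0" for v :: int
  proof (cases "v \<ge> 0")
    case True
    then have "1 \<le> real p powi v" using p by (simp add: power_int_def)
    with True show ?thesis by (simp add: power_int_minus field_simps)
  next
    case False
    then have "real p powi (- v) = real p ^ nat (- v)" by (simp add: power_int_def)
    with False p show ?thesis by (simp add: not_le)
  qed
  with assms(2) show ?thesis by (simp add: padic_int_rats_def padic_abs_def)
qed

text \<open>The exponents of the powers of p dividing \<open>z\<close> form an initial segment
  ending at the multiplicity. A cutoff \<open>L\<close> common to all factors later allows the sums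
  over factors and levels to be swapped.\<close>

lemma multiplicity_eq_sum_of_bool:
  assumes "prime p" "z \<noteq> 0" and L: "\<And>l. l > L \<Longrightarrow> \<not> int p ^ l dvd z"
  shows "int (multiplicity (int p) z) = (\<Sum>l=1..L. of_bool (int p ^ l dvd z))"
proof -
  have iff: "int p ^ l dvd z \<longleftrightarrow> l \<le> multiplicity (int p) z" for l
    using assms by (intro power_dvd_iff_le_multiplicity) auto
  then have "multiplicity (int p) z \<le> L" using L by (meson le_refl not_le)
  then have "{1..L} \<inter> {l. l \<le> multiplicity (int p) z} = {1..multiplicity (int p) z}"
    by auto
  then show ?thesis by (simp add: iff)
qed

text \<open>Every full block of \<open>m\<close> consecutive indices contains one hit, and the
  incomplete last block contains one iff it reaches beyond \<open>c\<close>.\<close>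

lemma sum_of_bool_mod_eq:
  assumes "c < m"
  shows "(\<Sum>k<n. of_bool (k mod m = c)) = n div m + of_bool (c < n mod (m::nat))"
proof (induction n)
  case (Suc n)
  have "n mod m < m" using assms by simp
  then show ?case using Suc assms
    by (auto simp: div_Suc mod_Suc)
qed simp

lemma length_filter_mono: "(\<And>x. x \<in> set xs \<Longrightarrow> P x \<Longrightarrow> Q x) \<Longrightarrow>
    length (filter P xs) \<le> length (filter Q xs)"
  by (induction xs) (auto simp: le_SucI)

lemma sum_of_bool_nth:
  "(\<Sum>i<length xs. of_bool (P (xs ! i))) = int (length (filter P xs))"
  by (simp add: length_filter_conv_card Int_def lessThan_def)

lemma christol_le_trans: "u \<preceq> v \<Longrightarrow> v \<preceq> w \<Longrightarrow> u \<preceq> w"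
  by (auto simp: christol_le_def)

subsection \<open>Residues of the parameters modulo prime powers\<close>

text \<open>\<open>X\<close> collects the parameters. With \<open>C\<close> the largest of their
  absolute values and \<open>d\<close> their common denominator, \<open>p_gt\<close> says that p
  exceeds \<open>hg_M\<close>.\<close>

locale christol =
  fixes X :: "rat set" and p d a :: nat and C :: real
  assumes prime_p: "prime p" and d_pos: "d > 0" and a_pos: "a > 0"
    and cong_ap: "[a * p = 1] (mod d)"
    and d_Ints: "x \<in> X \<Longrightarrow> of_nat d * x \<in> \<int>"
    and not_nonpos: "x \<in> X \<Longrightarrow> x \<notin> \<int>\<^sub>\<le>\<^sub>0"
    and abs_le_C: "x \<in> X \<Longrightarrow> \<bar>real_of_rat x\<bar> \<le> C"
    and C_nonneg: "C \<ge> 0"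
    and p_gt: "real p > real d * (2 + 2 * C)"
begin

text \<open>Multiplication by \<open>a\<close> inverts multiplication by p on multiples of 1/d
  modulo 1, so this is the class modulo 1 of the l-th Dwork iterate of \<open>x\<close>.\<close>

definition g :: "nat \<Rightarrow> rat \<Rightarrow> real" where
  "g l x = frac1 (real (a ^ l) * real_of_rat x)"

text \<open>For \<open>x \<in> X\<close> and \<open>l \<ge> 1\<close> the number under the floor is
  already a natural number, by \<open>\<rho>_aux\<close>; floor and \<open>nat\<close> act as type
  conversions.\<close>

definition \<rho> :: "nat \<Rightarrow> rat \<Rightarrow> nat" where
  "\<rho> l x = nat \<lfloor>real (p ^ l) * g l x - real_of_rat x\<rfloor>"

lemma coprime_d_a: "coprime d a" and coprime_p_d: "coprime p d"
proof -
  have "coprime (a * p) d"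
    using cong_ap cong_imp_coprime[of 1 "a * p" d] by (simp add: cong_sym)
  then show "coprime d a" "coprime p d" by (simp_all add: ac_simps)
qed

lemma p_pos: "p > 0" using prime_p prime_gt_0_nat by blast

lemma p_pow_ge: "l \<ge> 1 \<Longrightarrow> real (p ^ l) \<ge> real d * (real (p ^ (l - 1)) * (2 + 2 * C))"
proof -
  assume "l \<ge> 1"
  then have "real (p ^ l) = real (p ^ (l - 1)) * real p"
    by (metis le_add_diff_inverse2 of_nat_mult power_add power_one_right)
  also have "\<dots> \<ge> real (p ^ (l - 1)) * (real d * (2 + 2 * C))"
    using p_gt by (intro mult_left_mono) auto
  finally show ?thesis by (simp add: mult_ac)
qed

text \<open>Distinct values \<open>p ^ l * g l x\<close> are at least \<open>p ^ l / d\<close>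
  apart, while residues deviate from them by at most \<open>C\<close>. The factor
  \<open>p ^ (l - 1)\<close> leaves room for a multiple of \<open>p ^ (l - 1)\<close> between two
  clusters of residues.\<close>

lemma gap: "l \<ge> 1 \<Longrightarrow> real (p ^ l) / real d \<ge> real (p ^ (l - 1)) * (2 + 2 * C)"
  using p_pow_ge[of l] d_pos by (simp add: field_simps)

lemma one_le_pow: "1 \<le> real (p ^ l)"
  using p_pos by (metis One_nat_def Suc_leI of_nat_1 of_nat_le_iff zero_less_power)

lemma gap_gt: "l \<ge> 1 \<Longrightarrow> real (p ^ l) / real d \<ge> 2 + 2 * C"
proof -
  assume "l \<ge> 1"
  have "1 * (2 + 2 * C) \<le> real (p ^ (l - 1)) * (2 + 2 * C)"
    using one_le_pow C_nonneg by (intro mult_right_mono) auto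
  from order_trans[OF this gap[OF \<open>l \<ge> 1\<close>]] show ?thesis by (simp only: mult_1_left)
qed

lemma real_d_Ints: "x \<in> X \<Longrightarrow> real d * real_of_rat x \<in> \<int>"
  using d_Ints[of x] by (metis Ints_cases Ints_of_int of_rat_mult of_rat_of_int_eq of_rat_of_nat_eq)

lemma g_pos: "0 < g l x" and g_le_1: "g l x \<le> 1"
  unfolding g_def by (rule frac1_props)+

lemma d_g_Ints: "x \<in> X \<Longrightarrow> real d * g l x \<in> \<int>"
  unfolding g_def
  by (rule mult_frac1_Ints) (metis Ints_mult Ints_of_nat mult.left_commute real_d_Ints)

lemma spacing:
  assumes "real d * u \<in> \<int>" "real d * v \<in> \<int>" "u < v"
  shows "u + 1 / real d \<le> v"
proof -
  obtain i j where ij: "real d * u = of_int i" "real d * v = of_int j"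
    using assms(1,2) by (auto elim!: Ints_cases)
  have "real d * u < real d * v" using assms(3) d_pos by simp
  then have "i + 1 \<le> j" using ij by simp
  then have "real d * u + 1 \<le> real d * v" using ij by linarith
  then show ?thesis using d_pos by (simp add: field_simps)
qed

lemma pow_spacing:
  assumes "real d * u \<in> \<int>" "real d * v \<in> \<int>" "u < v"
  shows "real (p ^ l) * u + real (p ^ l) / real d \<le> real (p ^ l) * v"
  using mult_left_mono[OF spacing[OF assms], of "real (p ^ l)"] by (simp add: algebra_simps)

lemma \<rho>_aux:
  assumes x: "x \<in> X" and l: "l \<ge> 1"
  defines "R \<equiv> real (p ^ l) * g l x - real_of_rat x"
  shows "R \<in> \<int>" "real (p ^ (l - 1)) \<le> R" "R < real (p ^ l)"
proof -
  have ax: "real (a ^ l) * real_of_rat x - g l x \<in> \<int>"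
    unfolding g_def by (rule frac1_props)
  \<comment> \<open>Writing \<open>(a * p) ^ l - 1\<close> as \<open>d * w\<close> turns
    \<open>R\<close> into an integer combination of the integers \<open>d * x\<close> and
    \<open>a ^ l * x - g l x\<close>.\<close>
  have "[(a * p) ^ l = 1 ^ l] (mod d)" using cong_ap by (rule cong_pow)
  then have "[int ((a * p) ^ l) = int 1] (mod int d)" by (simp only: cong_int_iff power_one)
  then obtain w where w: "int ((a * p) ^ l) - 1 = int d * w"
    by (auto simp: cong_iff_dvd_diff)
  have wr: "real (p ^ l) * real (a ^ l) - 1 = real d * of_int w"
    using arg_cong[OF w, of real_of_int] by (simp add: power_mult_distrib mult_ac)
  have "R = (real (p ^ l) * real (a ^ l) - 1) * real_of_rat x
            - real (p ^ l) * (real (a ^ l) * real_of_rat x - g l x)"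
    unfolding R_def by (simp add: algebra_simps)
  also have "\<dots> = of_int w * (real d * real_of_rat x)
            - real (p ^ l) * (real (a ^ l) * real_of_rat x - g l x)"
    unfolding wr by (simp add: mult_ac)
  also have "\<dots> \<in> \<int>"
    by (intro Ints_diff[OF Ints_mult[OF Ints_of_int real_d_Ints[OF x]] Ints_mult[OF Ints_of_nat ax]])
  finally show R_int: "R \<in> \<int>" .
  have C: "\<bar>real_of_rat x\<bar> \<le> C" using abs_le_C[OF x] .
  have dg: "real d * g l x \<in> \<int>" using d_g_Ints[OF x] .
  \<comment> \<open>A positive multiple of 1/d is at least 1/d.\<close>
  have "real (p ^ l) * 0 + real (p ^ l) / real d \<le> real (p ^ l) * g l x"
    using dg g_pos by (intro pow_spacing) auto
  then have "real (p ^ (l - 1)) * (2 + 2 * C) \<le> real (p ^ l) * g l x"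
    using gap[OF l] by linarith
  moreover have "real (p ^ (l - 1)) * (2 + 2 * C) \<ge> 2 * real (p ^ (l - 1)) + C"
    using mult_right_mono[OF one_le_pow[of "l - 1"] C_nonneg] C_nonneg
    by (simp add: algebra_simps)
  ultimately show "real (p ^ (l - 1)) \<le> R"
    unfolding R_def using C one_le_pow[of "l - 1"] by linarith
  \<comment> \<open>If \<open>g l x = 1\<close>, then \<open>R = p ^ l - x\<close>, so
    \<open>x\<close> is an integer, and positive by \<open>not_nonpos\<close>. Otherwise
    \<open>g l x\<close> is at most \<open>1 - 1 / d\<close>.\<close>
  show "R < real (p ^ l)"
  proof (cases "g l x = 1")
    case True
    have "\<not> real_of_rat x \<le> 0"
    proof
      assume neg: "real_of_rat x \<le> 0"
      have "real_of_rat x = real (p ^ l) - R" using True by (simp add: R_def)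
      then have "real_of_rat x \<in> \<int>" using R_int by simp
      then obtain k where k: "real_of_rat x = of_int k" by (auto elim: Ints_cases)
      then have "x = of_int k" by (metis of_rat_eq_iff of_rat_of_int_eq)
      moreover have "k \<le> 0" using k neg by simp
      ultimately show False using not_nonpos[OF x] nonpos_Ints_of_int[of k, where 'a = rat] by simp
    qed
    then show ?thesis using True by (simp add: R_def)
  next
    case False
    then have "real (p ^ l) * g l x + real (p ^ l) / real d \<le> real (p ^ l) * 1"
      using dg g_le_1[of l x] by (intro pow_spacing) auto
    then show ?thesis using gap_gt[OF l] C C_nonneg unfolding R_def by linarith
  qed
qed

lemma real_\<rho>:
  assumes "x \<in> X" "l \<ge> 1"
  shows "real (\<rho> l x) = real (p ^ l) * g l x - real_of_rat x"
proof -
  have "0 \<le> real (p ^ l) * g l x - real_of_rat x"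
    using \<rho>_aux(2)[OF assms] one_le_pow[of "l - 1"] by linarith
  with \<rho>_aux(1)[OF assms] show ?thesis
    unfolding \<rho>_def by (auto elim!: Ints_cases)
qed

lemma \<rho>_bounds:
  assumes "x \<in> X" "l \<ge> 1"
  shows "p ^ (l - 1) \<le> \<rho> l x" "\<rho> l x < p ^ l"
  using \<rho>_aux(2,3)[OF assms] unfolding real_\<rho>[OF assms, symmetric] by simp_all

lemma \<rho>_ge_pow:
  assumes "x \<in> X" "L < l"
  shows "p ^ L \<le> \<rho> l x"
proof -
  have "p ^ L \<le> p ^ (l - 1)" using assms(2) p_pos by (intro power_increasing) auto
  then show ?thesis using \<rho>_bounds(1)[of x l] assms by simp
qed

text \<open>Multiplication by \<open>d\<close> turns \<open>x + k\<close> into the integer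
  \<open>u + d * k\<close>. At \<open>k = \<rho> l x\<close> this is \<open>p ^ l\<close> times the
  integer \<open>d * g l x\<close>, and \<open>d\<close> is a unit modulo
  \<open>p ^ l\<close>.\<close>

lemma pow_dvd_iff:
  assumes x: "x \<in> X" and l: "l \<ge> 1" and u: "of_int u = of_nat d * x"
  shows "int p ^ l dvd u + int d * int k \<longleftrightarrow> k mod p ^ l = \<rho> l x"
proof -
  obtain c where c: "real d * g l x = of_int c" using d_g_Ints[OF x] by (auto elim: Ints_cases)
  have ur: "real_of_int u = real d * real_of_rat x"
    using u by (metis of_rat_mult of_rat_of_int_eq of_rat_of_nat_eq)
  have "real_of_int (u + int d * int (\<rho> l x)) = real (p ^ l) * (real d * g l x)"
    by (simp add: real_\<rho>[OF x l] ur algebra_simps)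
  also have "\<dots> = of_int (int p ^ l * c)" by (simp add: c)
  finally have "u + int d * int (\<rho> l x) = int p ^ l * c" by linarith
  then have "u + int d * int k = int p ^ l * c + int d * (int k - int (\<rho> l x))"
    by (simp add: algebra_simps)
  then have "int p ^ l dvd u + int d * int k \<longleftrightarrow> int p ^ l dvd int d * (int k - int (\<rho> l x))"
    by (simp add: dvd_add_right_iff)
  also have "\<dots> \<longleftrightarrow> int p ^ l dvd int k - int (\<rho> l x)"
    using coprime_p_d by (intro coprime_dvd_mult_right_iff) simp
  also have "\<dots> \<longleftrightarrow> [int k = int (\<rho> l x)] (mod int (p ^ l))"
    by (simp add: cong_iff_dvd_diff)
  also have "\<dots> \<longleftrightarrow> k mod p ^ l = \<rho> l x"
    using \<rho>_bounds(2)[OF x l] unfolding cong_int_iff by (simp add: cong_def)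
  finally show ?thesis .
qed

lemma add_of_nat_nonzero: "x \<in> X \<Longrightarrow> x + of_nat k \<noteq> 0"
  using not_nonpos[of x] plus_of_nat_eq_0_imp[of x k] by blast

lemma pochhammer_nonzero: "x \<in> X \<Longrightarrow> pochhammer x n \<noteq> 0"
  using add_of_nat_nonzero[of x] by (auto simp: pochhammer_prod)

lemma padic_val_pochhammer:
  assumes x: "x \<in> X" and n: "n \<le> p ^ L"
  shows "padic_val p (pochhammer x n) =
           (\<Sum>l=1..L. int (n div p ^ l) + of_bool (\<rho> l x < n mod p ^ l))"
proof -
  obtain u where u: "of_int u = of_nat d * x" using d_Ints[OF x] by (auto elim: Ints_cases)
  have val: "padic_val p (x + of_nat k) = (\<Sum>l=1..L. of_bool (k mod p ^ l = \<rho> l x))"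
    if k: "k < n" for k
  proof -
    have eq: "x + of_nat k = of_int (u + int d * int k) / of_int (int d)"
      using d_pos u by (simp add: field_simps)
    then have nz: "u + int d * int k \<noteq> 0" using add_of_nat_nonzero[OF x, of k] by (metis div_0 of_int_0)
    have "\<not> int p dvd int d"
      using coprime_p_d prime_p by (auto simp: coprime_absorb_left)
    then have "multiplicity (int p) (int d) = 0" by (rule not_dvd_imp_multiplicity_0)
    then have "padic_val p (x + of_nat k) = int (multiplicity (int p) (u + int d * int k))"
      unfolding eq using padic_val_fraction[OF prime_p nz, of "int d"] d_pos by simp
    also have "\<dots> = (\<Sum>l=1..L. of_bool (int p ^ l dvd u + int d * int k))"
    proof (rule multiplicity_eq_sum_of_bool[OF prime_p nz])
      fix l assume l: "L < l"
      \<comment> \<open>The indices stay below \<open>p ^ L\<close>, whereas residues of levels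
        above \<open>L\<close> are at least \<open>p ^ L\<close>.\<close>
      have "k < \<rho> l x" using k n \<rho>_ge_pow[OF x l] by simp
      then have "k mod p ^ l \<noteq> \<rho> l x" using mod_less_eq_dividend[of k "p ^ l"] by linarith
      then show "\<not> int p ^ l dvd u + int d * int k" using pow_dvd_iff[OF x _ u] l by simp
    qed
    also have "\<dots> = (\<Sum>l=1..L. of_bool (k mod p ^ l = \<rho> l x))"
      using pow_dvd_iff[OF x _ u] by (intro sum.cong) auto
    finally show ?thesis .
  qed
  have "padic_val p (pochhammer x n) = (\<Sum>k<n. padic_val p (x + of_nat k))"
    unfolding pochhammer_prod
    using add_of_nat_nonzero[OF x] by (subst padic_val_prod[OF prime_p]) (auto simp: atLeast0LessThan)
  also have "\<dots> = (\<Sum>k<n. \<Sum>l=1..L. of_bool (k mod p ^ l = \<rho> l x))"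
    using val by simp
  also have "\<dots> = (\<Sum>l=1..L. \<Sum>k<n. of_bool (k mod p ^ l = \<rho> l x))"
    by (rule sum.swap)
  also have "\<dots> = (\<Sum>l=1..L. int (\<Sum>k<n. of_bool (k mod p ^ l = \<rho> l x)))"
    by simp
  also have "\<dots> = (\<Sum>l=1..L. int (n div p ^ l) + of_bool (\<rho> l x < n mod p ^ l))"
    using \<rho>_bounds(2)[OF x] by (intro sum.cong refl, subst sum_of_bool_mod_eq) auto
  finally show ?thesis .
qed

text \<open>The spacing \<open>p ^ l / d\<close> exceeds the combined shift by \<open>x\<close> and
  \<open>y\<close>, which is at most \<open>2 * C\<close>.\<close>

lemma g_less_imp_\<rho>_less:
  assumes "x \<in> X" "y \<in> X" "l \<ge> 1" "g l x < g l y"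
  shows "\<rho> l x < \<rho> l y"
proof -
  have "real (p ^ l) * g l x + real (p ^ l) / real d \<le> real (p ^ l) * g l y"
    using assms d_g_Ints by (intro pow_spacing) auto
  then have "real (\<rho> l x) < real (\<rho> l y)"
    using abs_le_C[OF assms(1)] abs_le_C[OF assms(2)] gap_gt[OF assms(3)] assms
    unfolding real_\<rho>[OF assms(1,3)] real_\<rho>[OF assms(2,3)] by linarith
  then show ?thesis by simp
qed

lemma christol_le_iff:
  "real (a ^ l) * real_of_rat x \<preceq> real (a ^ l) * real_of_rat y \<longleftrightarrow>
     g l x < g l y \<or> g l x = g l y \<and> x \<ge> y"
  using a_pos by (auto simp: christol_le_def g_def of_rat_less_eq)

text \<open>Within one class modulo 1 the residue is a constant minus \<open>x\<close>, which
  matches the reversed tie-break of \<open>christol_le\<close>.\<close>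

lemma \<rho>_le_iff:
  assumes "x \<in> X" "y \<in> X" "l \<ge> 1"
  shows "\<rho> l x \<le> \<rho> l y \<longleftrightarrow> g l x < g l y \<or> g l x = g l y \<and> x \<ge> y"
proof (cases "g l x = g l y")
  case True
  have "\<rho> l x \<le> \<rho> l y \<longleftrightarrow> real (\<rho> l x) \<le> real (\<rho> l y)" by simp
  also have "\<dots> \<longleftrightarrow> y \<le> x"
    unfolding real_\<rho>[OF assms(1,3)] real_\<rho>[OF assms(2,3)] by (simp add: True of_rat_less_eq)
  finally show ?thesis using True by simp
next
  case False
  then show ?thesis
    using g_less_imp_\<rho>_less[OF assms] g_less_imp_\<rho>_less[OF assms(2,1,3)] by fastforce
qed

section \<open>Comparison of different levels\<close>

lemma Ints_of_coprime_mult: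
  assumes "real d * u \<in> \<int>" "real (a ^ l) * u \<in> \<int>"
  shows "u \<in> \<int>"
proof -
  have "coprime (int d) (int (a ^ l))" using coprime_d_a by simp
  then obtain v w where "v * int d + w * int (a ^ l) = 1"
    by (metis bezout_int coprime_imp_gcd_eq_1)
  then have "real_of_int (v * int d + w * int (a ^ l)) * u = u" by simp
  then have "u = of_int v * (real d * u) + of_int w * (real (a ^ l) * u)"
    by (simp add: algebra_simps)
  also have "\<dots> \<in> \<int>" by (intro Ints_add Ints_mult[OF Ints_of_int] assms)
  finally show ?thesis .
qed

lemma g_eq_imp_diff_Ints:
  assumes "x \<in> X" "y \<in> X" "g l x = g l y"
  shows "real_of_rat x - real_of_rat y \<in> \<int>"
proof (rule Ints_of_coprime_mult)
  show "real d * (real_of_rat x - real_of_rat y) \<in> \<int>"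
    using Ints_diff[OF real_d_Ints[OF assms(1)] real_d_Ints[OF assms(2)]]
    by (simp add: right_diff_distrib)
  show "real (a ^ l) * (real_of_rat x - real_of_rat y) \<in> \<int>"
    using frac1_eq_imp_diff_Ints[OF assms(3)[unfolded g_def]] by (simp add: right_diff_distrib)
qed

text \<open>Equality at one level already forces \<open>x - y\<close> to be an integer, a condition
  that does not mention the level.\<close>

lemma g_eq_transfer:
  assumes "x \<in> X" "y \<in> X" "g l x = g l y"
  shows "g h x = g h y"
  unfolding g_def
proof (rule frac1_cong)
  have "real (a ^ h) * (real_of_rat x - real_of_rat y) \<in> \<int>"
    by (intro Ints_mult Ints_of_nat g_eq_imp_diff_Ints[OF assms])
  then show "real (a ^ h) * real_of_rat x - real (a ^ h) * real_of_rat y \<in> \<int>"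
    by (simp add: right_diff_distrib)
qed

text \<open>The residues of one class form a cluster that moves rigidly from level to level: both
  differences equal \<open>y - x\<close>.\<close>

lemma \<rho>_shift:
  assumes "x \<in> X" "y \<in> X" "l \<ge> 1" "h \<ge> 1" "g l x = g l y"
  shows "int (\<rho> h x) - int (\<rho> h y) = int (\<rho> l x) - int (\<rho> l y)"
proof -
  have "real (\<rho> h x) - real (\<rho> h y) = real (\<rho> l x) - real (\<rho> l y)"
    using assms(5) g_eq_transfer[OF assms(1,2,5), of h]
    by (simp only: real_\<rho>[OF assms(1,3)] real_\<rho>[OF assms(2,3)]
        real_\<rho>[OF assms(1,4)] real_\<rho>[OF assms(2,4)])
  then show ?thesis by linarith
qed

text \<open>\<open>\<rho> h x\<close> represents -x modulo \<open>p ^ h\<close>, hence also modulo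
  its divisor \<open>p ^ l\<close>.\<close>

lemma \<rho>_mod_pow:
  assumes "x \<in> X" "1 \<le> l" "l \<le> h"
  shows "\<rho> h x mod p ^ l = \<rho> l x"
proof -
  obtain u where u: "of_int u = of_nat d * x" using d_Ints[OF assms(1)] by (auto elim: Ints_cases)
  have "int p ^ h dvd u + int d * int (\<rho> h x)"
    using pow_dvd_iff[OF assms(1) _ u, of h] \<rho>_bounds(2)[OF assms(1), of h] assms by simp
  then have "int p ^ l dvd u + int d * int (\<rho> h x)"
    using le_imp_power_dvd[OF assms(3)] dvd_trans by blast
  then show ?thesis using pow_dvd_iff[OF assms(1,2) u] by simp
qed

lemma cong_pow_ord: "[a ^ (l + ord d a) = a ^ l] (mod d)"
  using cong_mult[OF cong_refl[of "a ^ l"] ord[of a d]] by (simp add: power_add)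

lemma ord_pos: "ord d a > 0"
  using coprime_d_a by simp

lemma g_add_ord: "x \<in> X \<Longrightarrow> g (l + ord d a) x = g l x"
proof -
  assume x: "x \<in> X"
  have "int d dvd int (a ^ (l + ord d a)) - int (a ^ l)"
    using cong_pow_ord[of l] by (simp only: cong_iff_dvd_diff flip: cong_int_iff)
  then obtain w where w: "int (a ^ (l + ord d a)) - int (a ^ l) = int d * w" by auto
  have "real (a ^ (l + ord d a)) - real (a ^ l) = real d * of_int w"
    using arg_cong[OF w, of real_of_int] by simp
  then have "real (a ^ (l + ord d a)) * real_of_rat x - real (a ^ l) * real_of_rat x
        = of_int w * (real d * real_of_rat x)"
    by (metis left_diff_distrib mult.assoc mult.commute)
  also have "\<dots> \<in> \<int>" by (intro Ints_mult Ints_of_int real_d_Ints[OF x])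
  finally show ?thesis unfolding g_def by (rule frac1_cong)
qed

end

lemma finite_maximizer:
  fixes f :: "'a \<Rightarrow> 'b :: linorder"
  assumes "finite S" "S \<noteq> {}"
  obtains x where "x \<in> S" "\<And>y. y \<in> S \<Longrightarrow> f y \<le> f x"
proof -
  have "Max (f ` S) \<in> f ` S" using assms by (intro Max_in) auto
  then obtain x where "x \<in> S" "f x = Max (f ` S)" by auto
  then show thesis using that[of x] assms(1) by simp
qed

text \<open>Splitting off a full period, whose sum is nonnegative, leaves a shorter sum. This
  extends the first condition of (iii) from \<open>h \<le> ord d a\<close> to all
  \<open>h\<close>.\<close>

lemma sum_periodic_nonneg:
  fixes f :: "nat \<Rightarrow> int"
  assumes "m > 0" and periodic: "\<And>l. f (l + m) = f l"
    and nonneg: "\<And>h. 1 \<le> h \<Longrightarrow> h \<le> m \<Longrightarrow> (\<Sum>l=1..h. f l) \<ge> 0"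
  shows "(\<Sum>l=1..h. f l) \<ge> 0"
proof (induction h rule: less_induct)
  case (less h)
  show ?case
  proof (cases "h \<le> m")
    case True
    then show ?thesis using nonneg[of h] by (cases "h = 0") auto
  next
    case False
    then obtain k where k: "h = k + m" by (metis add.commute le_iff_add nat_le_linear)
    have "(\<Sum>l=1..h. f l) = (\<Sum>l=1..m. f l) + (\<Sum>l=m+1..h. f l)"
      using sum.ub_add_nat[of 1 m f k] by (simp add: k add.commute)
    also have "(\<Sum>l=m+1..h. f l) = (\<Sum>l=1..k. f (l + m))"
      unfolding k by (subst sum.shift_bounds_cl_nat_ivl[symmetric]) (simp add: add.commute)
    finally show ?thesis
      using less[of k] nonneg[of m] \<open>m > 0\<close> k by (simp add: periodic)
  qed
qed

subsection \<open>Valuation of the coefficients\<close>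

locale christol_params = christol "set \<alpha> \<union> set \<beta>" p d a C
  for \<alpha> \<beta> :: "rat list" and p d a :: nat and C :: real
begin

abbreviation X where "X \<equiv> set \<alpha> \<union> set \<beta>"

abbreviation coeff_val :: "nat \<Rightarrow> int" where
  "coeff_val n \<equiv> padic_val p (fps_nth (hypergeo_series \<alpha> \<beta>) n)"

text \<open>Counting in the lists takes repeated parameters with multiplicity.\<close>

definition cnt :: "(rat \<Rightarrow> bool) \<Rightarrow> int" where
  "cnt P = int (length (filter P \<alpha>)) - int (length (filter P \<beta>))"

definition D :: "nat \<Rightarrow> nat \<Rightarrow> int" where
  "D l m = cnt (\<lambda>x. \<rho> l x < m)"

text \<open>The function delta of the theorem at the point \<open>a ^ l * x\<close> with multiplier
  \<open>a ^ l\<close>; see \<open>hg_delta_pow\<close>.\<close>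

definition \<delta> :: "nat \<Rightarrow> rat \<Rightarrow> int" where
  "\<delta> l x = cnt (\<lambda>y. g l y < g l x \<or> g l y = g l x \<and> y \<ge> x)"

lemma cnt_mono:
  assumes "\<And>x. x \<in> set \<alpha> \<Longrightarrow> P x \<Longrightarrow> Q x" "\<And>x. x \<in> set \<beta> \<Longrightarrow> Q x \<Longrightarrow> P x"
  shows "cnt P \<le> cnt Q"
  using length_filter_mono[of \<alpha> P Q] length_filter_mono[of \<beta> Q P] assms by (simp add: cnt_def)

lemma cnt_cong: "(\<And>x. x \<in> X \<Longrightarrow> P x = Q x) \<Longrightarrow> cnt P = cnt Q"
  by (intro antisym cnt_mono) auto

lemma cnt_True: "(\<And>x. x \<in> X \<Longrightarrow> P x) \<Longrightarrow> cnt P = int (length \<alpha>) - int (length \<beta>)"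
  by (simp add: cnt_def)

lemma cnt_False: "(\<And>x. x \<in> X \<Longrightarrow> \<not> P x) \<Longrightarrow> cnt P = 0"
  by (simp add: cnt_def)

lemma hg_delta_eq_cnt: "hg_delta \<alpha> \<beta> z b = cnt (\<lambda>y. real b * real_of_rat y \<preceq> z)"
  by (simp add: hg_delta_def cnt_def length_filter_conv_card)

lemma hg_delta_pow: "hg_delta \<alpha> \<beta> (real (a ^ l) * real_of_rat x) (a ^ l) = \<delta> l x"
  unfolding hg_delta_eq_cnt christol_le_iff \<delta>_def ..

lemma \<delta>_eq_D: "x \<in> X \<Longrightarrow> l \<ge> 1 \<Longrightarrow> \<delta> l x = D l (\<rho> l x + 1)"
  unfolding \<delta>_def D_def by (intro cnt_cong) (auto simp: less_Suc_eq_le \<rho>_le_iff)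

lemma D_0: "D l 0 = 0"
  by (simp add: D_def cnt_def)

lemma D_ge_length: "D l m \<ge> - int (length \<beta>)"
  using length_filter_le[of "\<lambda>x. \<rho> l x < m" \<beta>] unfolding D_def cnt_def by linarith

lemma D_full: "l \<ge> 1 \<Longrightarrow> D l (p ^ l) = int (length \<alpha>) - int (length \<beta>)"
  unfolding D_def using \<rho>_bounds(2) by (intro cnt_True)

text \<open>As a function of \<open>m\<close>, \<open>D l m\<close> is a step function that starts
  at 0 and changes only just after a residue; the largest residue below \<open>m\<close> determines
  its value.\<close>

lemma D_cases:
  obtains "D l m = 0" | x where "x \<in> X" "\<rho> l x < m" "D l m = D l (\<rho> l x + 1)"
proof (cases "\<exists>x\<in>X. \<rho> l x < m")
  case False
  then show ?thesis using that(1) by (auto simp: D_def intro: cnt_False)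
next
  case True
  define S where "S = {x \<in> X. \<rho> l x < m}"
  have "finite S" "S \<noteq> {}" using True by (auto simp: S_def)
  then obtain x where x: "x \<in> S" "\<And>y. y \<in> S \<Longrightarrow> \<rho> l y \<le> \<rho> l x"
    using finite_maximizer[of S "\<rho> l"] by metis
  have "\<rho> l y < m \<longleftrightarrow> \<rho> l y < \<rho> l x + 1" if "y \<in> X" for y
  proof
    show "\<rho> l y < \<rho> l x + 1" if "\<rho> l y < m"
      using x(2)[of y] that \<open>y \<in> X\<close> by (simp add: S_def)
    show "\<rho> l y < m" if "\<rho> l y < \<rho> l x + 1" using x(1) that by (simp add: S_def)
  qed
  then have "D l m = D l (\<rho> l x + 1)" unfolding D_def by (rule cnt_cong)
  with x(1) show ?thesis using that(2)[of x] by (simp add: S_def)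
qed

lemma coeff_nonzero: "fps_nth (hypergeo_series \<alpha> \<beta>) n \<noteq> 0"
  using pochhammer_nonzero by (simp add: hypergeo_series_def)

lemma coeff_val_eq:
  assumes n: "n \<le> p ^ L"
  shows "coeff_val n = (\<Sum>l=1..L. (int (length \<alpha>) - int (length \<beta>)) * int (n div p ^ l)
                            + D l (n mod p ^ l))"
proof -
  \<comment> \<open>Stated for a general list, to serve numerator and denominator alike.\<close>
  have val: "padic_val p (\<Prod>i<length xs. pochhammer (xs ! i) n)
      = (\<Sum>l=1..L. int (length xs) * int (n div p ^ l)
           + int (length (filter (\<lambda>x. \<rho> l x < n mod p ^ l) xs)))"
    if xs: "set xs \<subseteq> X" for xs
  proof -
    have inner: "(\<Sum>i<length xs. int (n div p ^ l) + of_bool (\<rho> l (xs ! i) < n mod p ^ l))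
        = int (length xs) * int (n div p ^ l)
           + int (length (filter (\<lambda>x. \<rho> l x < n mod p ^ l) xs))" for l
      by (simp only: sum.distrib sum_of_bool_nth[where P = "\<lambda>x. \<rho> l x < n mod p ^ l"]) simp
    have "padic_val p (\<Prod>i<length xs. pochhammer (xs ! i) n)
        = (\<Sum>i<length xs. padic_val p (pochhammer (xs ! i) n))"
      using xs pochhammer_nonzero nth_mem by (intro padic_val_prod[OF prime_p]) blast+
    also have "\<dots> = (\<Sum>i<length xs. \<Sum>l=1..L.
        int (n div p ^ l) + of_bool (\<rho> l (xs ! i) < n mod p ^ l))"
      using xs nth_mem by (intro sum.cong refl padic_val_pochhammer n) blast
    also have "\<dots> = (\<Sum>l=1..L. \<Sum>i<length xs.
        int (n div p ^ l) + of_bool (\<rho> l (xs ! i) < n mod p ^ l))"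
      by (rule sum.swap)
    also have "\<dots> = (\<Sum>l=1..L. int (length xs) * int (n div p ^ l)
           + int (length (filter (\<lambda>x. \<rho> l x < n mod p ^ l) xs)))"
      by (simp only: inner)
    finally show ?thesis .
  qed
  have "coeff_val n = padic_val p (\<Prod>i<length \<alpha>. pochhammer (\<alpha> ! i) n)
      - padic_val p (\<Prod>i<length \<beta>. pochhammer (\<beta> ! i) n)"
    unfolding hypergeo_series_def fps_nth_Abs_fps using pochhammer_nonzero
    by (intro padic_val_divide[OF prime_p]) auto
  also have "\<dots> = (\<Sum>l=1..L. (int (length \<alpha>) - int (length \<beta>)) * int (n div p ^ l)
                            + D l (n mod p ^ l))"
    by (simp add: val D_def cnt_def sum_subtractf[symmetric] algebra_simps)
  finally show ?thesis .
qed

lemma in_padic_int_fps_iff: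
  "hypergeo_series \<alpha> \<beta> \<in> padic_int_fps p \<longleftrightarrow> (\<forall>n. coeff_val n \<ge> 0)"
  unfolding padic_int_fps_def by (simp add: padic_int_rats_iff[OF prime_p coeff_nonzero])

section \<open>Unequally many parameters\<close>

lemma not_integral_if_less:
  assumes "length \<alpha> < length \<beta>"
  shows "hypergeo_series \<alpha> \<beta> \<notin> padic_int_fps p"
proof -
  \<comment> \<open>At the only level, 1, the quotient is 1 and the remainder 0, so the valuation is
    r - s.\<close>
  have "coeff_val p < 0"
    using coeff_val_eq[of p 1] p_pos assms by (simp add: D_0)
  then show ?thesis unfolding in_padic_int_fps_iff by (auto simp: not_le)
qed

text \<open>The endpoint \<open>n = p ^ l\<close> is what needs care: quotient 1 and remainder 0
  give r - s, which is also \<open>D l (p ^ l)\<close>. It occurs for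
  \<open>n = \<rho> l x + 1\<close> when the residue is \<open>p ^ l - 1\<close>.\<close>

lemma level_term_full:
  assumes "l \<ge> 1" "n \<le> p ^ l"
  shows "(int (length \<alpha>) - int (length \<beta>)) * int (n div p ^ l) + D l (n mod p ^ l) = D l n"
proof (cases "n = p ^ l")
  case True
  then show ?thesis using D_full[OF assms(1)] p_pos by (simp add: D_0)
next
  case False
  then show ?thesis using assms by simp
qed

text \<open>By \<open>D_cases\<close> it suffices to take \<open>m = \<rho> 1 x + 1\<close>; this is
  at most p, so level 1 gives the whole valuation of that coefficient.\<close>

lemma integral_imp_D_1_nonneg:
  assumes "\<And>n. coeff_val n \<ge> 0"
  shows "D 1 m \<ge> 0"
proof (cases rule: D_cases[of 1 m])
  case (2 x)
  have "\<rho> 1 x + 1 \<le> p ^ 1" using \<rho>_bounds(2)[of x 1] 2 by simp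
  then have "coeff_val (\<rho> 1 x + 1) = D 1 (\<rho> 1 x + 1)"
    using coeff_val_eq[of "\<rho> 1 x + 1" 1] level_term_full[of 1 "\<rho> 1 x + 1"] by simp
  then show ?thesis using 2 assms[of "\<rho> 1 x + 1"] by simp
qed simp

lemma D_1_nonneg_iff: "(\<forall>m. D 1 m \<ge> 0) \<longleftrightarrow> (\<forall>z. hg_delta \<alpha> \<beta> z a \<ge> 0)"
proof (intro iffI allI)
  fix z assume D: "\<forall>m. D 1 m \<ge> 0"
  \<comment> \<open>By transitivity \<open>S\<close> is an initial segment for the order by
    \<open>\<rho> 1\<close>, so its last element \<open>x\<close> turns the count into
    \<open>D 1 (\<rho> 1 x + 1)\<close>.\<close>
  define S where "S = {x \<in> X. real a * real_of_rat x \<preceq> z}"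
  show "hg_delta \<alpha> \<beta> z a \<ge> 0"
  proof (cases "S = {}")
    case True
    then show ?thesis unfolding hg_delta_eq_cnt by (subst cnt_False) (auto simp: S_def)
  next
    case False
    moreover have "finite S" by (simp add: S_def)
    ultimately obtain x where x: "x \<in> S" "\<And>y. y \<in> S \<Longrightarrow> \<rho> 1 y \<le> \<rho> 1 x"
      using finite_maximizer[of S "\<rho> 1"] by metis
    have "real a * real_of_rat y \<preceq> z \<longleftrightarrow> \<rho> 1 y < \<rho> 1 x + 1" if y: "y \<in> X" for y
    proof
      assume "real a * real_of_rat y \<preceq> z"
      then show "\<rho> 1 y < \<rho> 1 x + 1" using x(2)[of y] y by (simp add: S_def)
    next
      assume "\<rho> 1 y < \<rho> 1 x + 1"
      then have "real (a ^ 1) * real_of_rat y \<preceq> real (a ^ 1) * real_of_rat x"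
        unfolding christol_le_iff using \<rho>_le_iff[of y x 1] y x(1) by (simp add: S_def)
      then show "real a * real_of_rat y \<preceq> z"
        using christol_le_trans x(1) unfolding S_def by (metis (lifting) mem_Collect_eq power_one_right)
    qed
    then have "hg_delta \<alpha> \<beta> z a = D 1 (\<rho> 1 x + 1)"
      unfolding hg_delta_eq_cnt D_def by (rule cnt_cong)
    then show ?thesis using D by simp
  qed
next
  fix m assume "\<forall>z. hg_delta \<alpha> \<beta> z a \<ge> 0"
  then have \<delta>: "\<delta> 1 x \<ge> 0" for x by (simp flip: hg_delta_pow)
  show "D 1 m \<ge> 0"
  proof (cases rule: D_cases[of 1 m])
    case (2 x)
    then show ?thesis using \<delta>[of x] \<delta>_eq_D[of x 1] by simp
  qed simp
qed

text \<open>Level 1 contributes at least \<open>n div p\<close>, every level at least -s. If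
  \<open>K\<close> is the last level with a residue below \<open>n\<close>, then \<open>n\<close> is
  so large that \<open>n div p\<close> pays for all levels from 2 to \<open>K\<close>.\<close>

lemma greater_imp_coeff_val_nonneg:
  assumes gr: "length \<alpha> > length \<beta>" and D: "\<And>m. D 1 m \<ge> 0"
    and s: "length \<beta> > 0" and p3: "p > 3 * length \<beta> * d"
  shows "coeff_val n \<ge> 0"
proof -
  define T where "T l = (int (length \<alpha>) - int (length \<beta>)) * int (n div p ^ l)
    + D l (n mod p ^ l)" for l
  have "n \<le> p ^ n" using power_gt_expt[of p n] prime_gt_1_nat[OF prime_p] by simp
  then have V: "coeff_val n = (\<Sum>l=1..n. T l)" unfolding T_def by (rule coeff_val_eq)
  have T_ge: "T l \<ge> int (n div p ^ l) + D l (n mod p ^ l)" for l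
    using mult_right_mono[of 1 "int (length \<alpha>) - int (length \<beta>)" "int (n div p ^ l)"] gr
    by (simp add: T_def)
  have T1: "T 1 \<ge> int (n div p)" using T_ge[of 1] D[of "n mod p"] by simp
  have T_low: "T l \<ge> - int (length \<beta>)" for l
    using T_ge[of l] D_ge_length[of l "n mod p ^ l"] by linarith
  \<comment> \<open>The levels at which \<open>D\<close> can be nonzero, apart from level 1; all
    other terms are nonnegative.\<close>
  define S where "S = {l \<in> {2..n}. \<exists>x\<in>X. \<rho> l x < n}"
  have T_nonneg: "T l \<ge> 0" if l: "l \<in> {1..n}" "l \<notin> S" for l
  proof (cases "l = 1")
    case False
    have "\<not> \<rho> l x < n mod p ^ l" if "x \<in> X" for x
    proof -
      have "l \<in> {2..n}" using l(1) False by auto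
      then have "\<not> \<rho> l x < n" using l(2) that by (auto simp: S_def)
      then show ?thesis using mod_less_eq_dividend[of n "p ^ l"] by linarith
    qed
    then have "D l (n mod p ^ l) = 0" unfolding D_def by (intro cnt_False)
    then show ?thesis using T_ge[of l] by linarith
  next
    case True
    then show ?thesis using order_trans[OF of_nat_0_le_iff T1] by simp
  qed
  show ?thesis
  proof (cases "S = {}")
    case True
    then show ?thesis unfolding V using T_nonneg by (intro sum_nonneg) auto
  next
    case False
    define K where "K = Max S"
    have fin: "finite S" by (simp add: S_def)
    have K: "K \<in> S" "\<And>l. l \<in> S \<Longrightarrow> l \<le> K" using Max_in[OF fin False] Max_ge[OF fin] by (auto simp: K_def)
    then obtain x where x: "x \<in> X" "\<rho> K x < n" and K2: "2 \<le> K" "K \<le> n" by (auto simp: S_def)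
    \<comment> \<open>There are \<open>j + 1\<close> levels from 2 to \<open>K\<close>, and dividing
      \<open>p ^ (K - 1)\<close> by p leaves \<open>p ^ j\<close>.\<close>
    define j where "j = K - 2"
    have j: "K = j + 2" using K2 by (simp add: j_def)
    have dp: "real (p ^ K) / real d \<ge> real (3 * length \<beta>) * real (p ^ (j + 1))"
    proof -
      have "real (3 * length \<beta> * d) * real (p ^ (j + 1)) \<le> real p * real (p ^ (j + 1))"
        using p3 by (intro mult_right_mono) (auto simp del: of_nat_mult)
      then show ?thesis using d_pos by (simp add: j field_simps)
    qed
    have "real (p ^ K) * 0 + real (p ^ K) / real d \<le> real (p ^ K) * g K x"
      using d_g_Ints[OF x(1)] g_pos by (intro pow_spacing) auto
    moreover have "1 * (2 + 2 * C) \<le> real d * (2 + 2 * C)"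
      using d_pos C_nonneg by (intro mult_right_mono) auto
    from le_less_trans[OF this p_gt] have "C \<le> real p" using C_nonneg by simp
    ultimately have "real (3 * length \<beta>) * real (p ^ (j + 1)) < real n + real p"
      using dp abs_le_C[OF x(1)] x(2) real_\<rho>[OF x(1), of K] K2 by linarith
    then have "real (3 * length \<beta> * p ^ (j + 1)) < real (n + p)"
      by (simp only: of_nat_mult of_nat_add)
    then have "3 * length \<beta> * p ^ (j + 1) < n + p" by (simp only: of_nat_less_iff)
    \<comment> \<open>Rounding \<open>n\<close> up to a multiple of p costs one p, and the bound
      \<open>C \<le> p\<close> on the shift by \<open>x\<close> another; hence the 2 below, which
      the factor 3 absorbs.\<close>
    also have "n < (n div p + 1) * p"
      using p_pos by (simp add: dividend_less_div_times)
    finally have "3 * length \<beta> * p ^ j * p < (n div p + 2) * p" by (simp add: algebra_simps)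
    then have lt: "3 * length \<beta> * p ^ j < n div p + 2" by (simp only: mult_less_cancel2)
    have "j + 1 \<le> p ^ j"
      using power_gt_expt[of p j] prime_gt_1_nat[OF prime_p] by simp
    then have "3 * length \<beta> * (j + 1) \<le> 3 * length \<beta> * p ^ j" by (rule mult_le_mono2)
    with lt have "3 * (length \<beta> * (j + 1)) < n div p + 2" by simp
    moreover have "length \<beta> * (j + 1) > 0" using s by (intro mult_pos_pos) auto
    ultimately have q: "length \<beta> * (j + 1) \<le> n div p" by linarith
    have "(\<Sum>l=1..n. T l) = (\<Sum>l=1..K. T l) + (\<Sum>l=K+1..n. T l)"
      using sum.ub_add_nat[of 1 K T "n - K"] K2 by simp
    moreover have "(\<Sum>l=1..K. T l) = T 1 + (\<Sum>l=2..K. T l)"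
      using sum.atLeast_Suc_atMost[of 1 K T] K2 by (simp add: numeral_2_eq_2)
    moreover have "(\<Sum>l=K+1..n. T l) \<ge> 0"
    proof (intro sum_nonneg T_nonneg)
      fix l assume "l \<in> {K+1..n}"
      then show "l \<in> {1..n}" "l \<notin> S" using K(2)[of l] by auto
    qed
    moreover have "(\<Sum>l=2..K. T l) \<ge> (\<Sum>l=2..K. - int (length \<beta>))"
      by (intro sum_mono T_low)
    then have "(\<Sum>l=2..K. T l) \<ge> - int (length \<beta> * (j + 1))"
      by (simp add: j algebra_simps)
    ultimately show ?thesis unfolding V using T1 q by linarith
  qed
qed

subsection \<open>Equally many parameters\<close>

text \<open>For \<open>n = \<rho> h x + 1\<close> the remainder at each level
  \<open>l \<le> h\<close> is \<open>\<rho> l x + 1\<close>, or 0 if that number is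
  \<open>p ^ l\<close>; for r = s both cases give \<open>\<delta> l x\<close>.\<close>

lemma integral_imp_sum_\<delta>_nonneg:
  assumes eq: "length \<alpha> = length \<beta>" and V: "\<And>n. coeff_val n \<ge> 0"
    and x: "x \<in> X" and h: "h \<ge> 1"
  shows "(\<Sum>l=1..h. \<delta> l x) \<ge> 0"
proof -
  have n: "\<rho> h x + 1 \<le> p ^ h" using \<rho>_bounds(2)[OF x h] by simp
  have "D l ((\<rho> h x + 1) mod p ^ l) = \<delta> l x" if l: "l \<in> {1..h}" for l
  proof -
    have "(\<rho> h x + 1) mod p ^ l = (\<rho> l x + 1) mod p ^ l"
      using \<rho>_mod_pow[OF x, of l h] l mod_add_left_eq[of "\<rho> h x" "p ^ l" 1] by simp
    moreover have "\<rho> l x + 1 \<le> p ^ l" using \<rho>_bounds(2)[OF x, of l] l by simp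
    then have "D l ((\<rho> l x + 1) mod p ^ l) = D l (\<rho> l x + 1)"
      using level_term_full[of l "\<rho> l x + 1"] eq l by simp
    ultimately show ?thesis using \<delta>_eq_D[OF x, of l] l by simp
  qed
  then have "coeff_val (\<rho> h x + 1) = (\<Sum>l=1..h. \<delta> l x)"
    unfolding coeff_val_eq[OF n] by (intro sum.cong) (use eq in auto)
  then show ?thesis using V[of "\<rho> h x + 1"] by simp
qed

text \<open>A multiple \<open>n\<close> of \<open>p ^ (l - 1)\<close> has remainder 0 at all lower
  levels, so only level \<open>l\<close> is seen. It is placed above the residues with
  \<open>g l y \<le> t\<close> and below the others.\<close>

lemma integral_imp_coarse_nonneg:
  assumes eq: "length \<alpha> = length \<beta>" and V: "\<And>n. coeff_val n \<ge> 0"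
    and t: "real d * t \<in> \<int>" "0 < t" "t \<le> 1" and l: "l \<ge> 1"
  shows "cnt (\<lambda>y. g l y \<le> t) \<ge> 0"
proof (cases "t = 1")
  case True
  then show ?thesis using cnt_True[of "\<lambda>y. g l y \<le> t"] g_le_1 eq by simp
next
  case False
  define P where "P = real (p ^ (l - 1))"
  have P: "P \<ge> 1" unfolding P_def by (rule one_le_pow)
  have pl: "p ^ l = p ^ (l - 1) * p" using l by (cases l) auto
  then have rpl: "real (p ^ l) = P * real p" by (simp add: P_def)
  have gap1: "real (p ^ l) / real d \<ge> P * (2 + 2 * C)" using gap[OF l] by (simp add: P_def)
  \<comment> \<open>The least integer above \<open>p * t + C\<close>: then \<open>n\<close> exceeds
    \<open>p ^ l * t + C\<close>, but \<open>p ^ l * t\<close> by no more than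
    \<open>p ^ (l - 1) * (C + 1)\<close>.\<close>
  define c where "c = nat (\<lfloor>real p * t + C\<rfloor> + 1)"
  have "real p * t + C \<ge> 0" using t C_nonneg by simp
  then have "real c = of_int \<lfloor>real p * t + C\<rfloor> + 1" by (simp add: c_def)
  then have c: "real p * t + C < real c" "real c \<le> real p * t + C + 1" by linarith+
  define n where "n = p ^ (l - 1) * c"
  have n: "real n = P * real c" by (simp add: n_def P_def)
  have low: "P * real p * t + P * C < real n"
    using mult_strict_left_mono[OF c(1), of P] P by (simp add: n algebra_simps)
  have high: "real n \<le> P * real p * t + P * C + P"
    using mult_left_mono[OF c(2), of P] P by (simp add: n algebra_simps)
  have PC: "C \<le> P * C" using mult_right_mono[OF P C_nonneg] by simp
  \<comment> \<open>Any larger multiple \<open>v\<close> of 1/d is still out of reach;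
    \<open>v = 1\<close> yields \<open>n < p ^ l\<close>, and \<open>v = g l x\<close> the residues
    to be excluded.\<close>
  have next_gap: "real n + C < real (p ^ l) * v" if "real d * v \<in> \<int>" "t < v" for v
  proof -
    have "real (p ^ l) * t + real (p ^ l) / real d \<le> real (p ^ l) * v"
      using t that by (intro pow_spacing)
    then have "P * real p * t + P * (2 + 2 * C) \<le> real (p ^ l) * v"
      using gap1 by (simp only: rpl)
    then have "P * real p * t + (2 * P + 2 * (P * C)) \<le> real (p ^ l) * v"
      by (simp add: algebra_simps)
    then show ?thesis using high PC P by linarith
  qed
  have "real n + C < real (p ^ l)" using next_gap[of 1] False t by simp
  then have n_lt: "n < p ^ l" using C_nonneg by linarith
  have iff: "\<rho> l x < n \<longleftrightarrow> g l x \<le> t" if x: "x \<in> X" for x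
  proof
    assume "\<rho> l x < n"
    show "g l x \<le> t"
    proof (rule ccontr)
      assume "\<not> g l x \<le> t"
      then have "real n + C < real (p ^ l) * g l x" using d_g_Ints[OF x] by (intro next_gap) auto
      then have "real n < real (\<rho> l x)"
        using real_\<rho>[OF x l] abs_le_C[OF x] by linarith
      then show False using \<open>\<rho> l x < n\<close> by simp
    qed
  next
    assume "g l x \<le> t"
    then have "real (p ^ l) * g l x \<le> real (p ^ l) * t" by (intro mult_left_mono) auto
    then have "real (\<rho> l x) < real n"
      using real_\<rho>[OF x l] abs_le_C[OF x] low PC unfolding rpl by linarith
    then show "\<rho> l x < n" by simp
  qed
  have low_levels: "D k (n mod p ^ k) = 0" if "k \<in> {1..<l}" for k
  proof -
    have "p ^ k dvd p ^ (l - 1)" using that by (intro le_imp_power_dvd) auto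
    then have "n mod p ^ k = 0" by (simp add: n_def)
    then show ?thesis by (simp add: D_0)
  qed
  have "coeff_val n = (\<Sum>k=1..l. D k (n mod p ^ k))"
    using coeff_val_eq[of n l] n_lt eq by simp
  also have "{1..l} = insert l {1..<l}" using l by auto
  also have "(\<Sum>k\<in>insert l {1..<l}. D k (n mod p ^ k)) = D l n"
    using n_lt by (simp add: low_levels)
  also have "\<dots> = cnt (\<lambda>y. g l y \<le> t)" unfolding D_def by (rule cnt_cong) (rule iff)
  finally show ?thesis using V[of n] by simp
qed

text \<open>
  At the highest level \<open>h\<close> with a negative contribution, \<open>n mod p ^ h\<close> must lie between two
  residues \<open>\<rho> h y\<close> and \<open>\<rho> h x\<close> whose parameters differ by an integer; this pins
  \<open>n mod p ^ l\<close> to the same position relative to \<open>\<rho> l y\<close> at all levels \<open>l \<le> h\<close>.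
\<close>

lemma sum_D_nonneg:
  assumes A: "\<And>h x. x \<in> set \<beta> \<Longrightarrow> h \<ge> 1 \<Longrightarrow> (\<Sum>l=1..h. \<delta> l x) \<ge> 0"
    and B: "\<And>l x. x \<in> X \<Longrightarrow> l \<ge> 1 \<Longrightarrow> cnt (\<lambda>y. g l y \<le> g l x) \<ge> 0"
  shows "(\<Sum>l=1..L. D l (n mod p ^ l)) \<ge> 0"
proof (cases "\<exists>l\<in>{1..L}. D l (n mod p ^ l) < 0")
  case False
  then show ?thesis by (intro sum_nonneg) (auto simp: not_less)
next
  case True
  define S where "S = {l \<in> {1..L}. D l (n mod p ^ l) < 0}"
  have S: "finite S" "S \<noteq> {}" using True by (auto simp: S_def)
  define h where "h = Max S"
  have h: "h \<in> S" "\<And>l. l \<in> S \<Longrightarrow> l \<le> h"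
    using Max_in[OF S] Max_ge[OF S(1)] by (simp_all add: h_def)
  have h1: "1 \<le> h" "h \<le> L" and neg: "D h (n mod p ^ h) < 0" using h(1) by (auto simp: S_def)
  define m where "m = n mod p ^ h"
  define Y where "Y = {y \<in> set \<beta>. \<rho> h y < m}"
  have "filter (\<lambda>x. \<rho> h x < m) \<beta> \<noteq> []"
    using neg by (auto simp: D_def cnt_def m_def)
  then have "Y \<noteq> {}" by (auto simp: Y_def filter_empty_conv)
  moreover have "finite Y" by (simp add: Y_def)
  ultimately obtain y where y: "y \<in> Y" and y_max: "\<And>z. z \<in> Y \<Longrightarrow> \<rho> h z \<le> \<rho> h y"
    using finite_maximizer[of Y "\<rho> h"] by metis
  have yX: "y \<in> X" "y \<in> set \<beta>" and y_lt: "\<rho> h y < m" using y by (auto simp: Y_def)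
  \<comment> \<open>Otherwise \<open>m\<close> lies above every residue of \<alpha> in the classes
    up to that of \<open>y\<close>, and \<open>D h m\<close> is at least a count that
    \<open>B\<close> makes nonnegative.\<close>
  have "\<exists>x\<in>set \<alpha>. g h x \<le> g h y \<and> m \<le> \<rho> h x"
  proof (rule ccontr)
    assume no: "\<not> ?thesis"
    have "cnt (\<lambda>z. g h z \<le> g h y) \<le> D h m"
      unfolding D_def
    proof (rule cnt_mono)
      show "\<rho> h z < m" if "z \<in> set \<alpha>" "g h z \<le> g h y" for z
        using no that by (auto simp: not_le)
      show "g h z \<le> g h y" if "z \<in> set \<beta>" "\<rho> h z < m" for z
        using y_max[of z] that \<rho>_le_iff[of z y h] yX(1) h1(1) by (auto simp: Y_def)
    qed
    then show False using B[OF yX(1) h1(1)] neg by (simp add: m_def)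
  qed
  then obtain x where x: "x \<in> set \<alpha>" and gx: "g h x \<le> g h y" and m_le: "m \<le> \<rho> h x" by blast
  have xX: "x \<in> X" using x by simp
  have geq: "g h x = g h y"
    using gx m_le y_lt g_less_imp_\<rho>_less[OF xX yX(1) h1(1)] by fastforce
  \<comment> \<open>The offset of \<open>m\<close> from \<open>y\<close>. As \<open>x\<close> and
    \<open>y\<close> lie in one cluster, \<open>\<rho> l y + t \<le> \<rho> l x < p ^ l\<close> at
    every level, so the remainder does not wrap around.\<close>
  define t where "t = m - \<rho> h y"
  have t: "m = \<rho> h y + t" "t > 0" using y_lt by (auto simp: t_def)
  have D_ge: "D l (n mod p ^ l) \<ge> \<delta> l y" if l: "1 \<le> l" "l \<le> h" for l
  proof -
    have geq_l: "g l x = g l y" by (rule g_eq_transfer[OF xX yX(1) geq])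
    have shift: "int (\<rho> h x) - int (\<rho> h y) = int (\<rho> l x) - int (\<rho> l y)"
      by (rule \<rho>_shift[OF xX yX(1) l(1) h1(1) geq_l])
    then have le: "\<rho> l y + t \<le> \<rho> l x" using m_le t by linarith
    have "n mod p ^ l = m mod p ^ l"
      unfolding m_def using l by (simp add: mod_mod_cancel le_imp_power_dvd)
    also have "\<dots> = (\<rho> l y + t) mod p ^ l"
      unfolding t(1) using mod_add_left_eq[of "\<rho> h y" "p ^ l" t] \<rho>_mod_pow[OF yX(1) l] by simp
    also have "\<dots> = \<rho> l y + t" using le \<rho>_bounds(2)[OF xX l(1)] by simp
    finally have nm: "n mod p ^ l = \<rho> l y + t" .
    show ?thesis
      unfolding nm D_def \<delta>_def
    proof (rule cnt_mono)
      fix z assume "z \<in> set \<alpha>" "g l z < g l y \<or> g l z = g l y \<and> y \<le> z"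
      then show "\<rho> l z < \<rho> l y + t" using \<rho>_le_iff[of z y l] yX l t by auto
    next
      fix z assume z: "z \<in> set \<beta>" and lt: "\<rho> l z < \<rho> l y + t"
      have zX: "z \<in> X" using z by simp
      \<comment> \<open>A residue of \<beta> strictly between \<open>\<rho> l y\<close> and
        \<open>\<rho> l y + t\<close> is squeezed into the class of \<open>y\<close> and
        \<open>x\<close>; shifted to level \<open>h\<close> it contradicts the maximality of
        \<open>y\<close>.\<close>
      have "\<rho> l z \<le> \<rho> l y"
      proof (rule ccontr)
        assume gt: "\<not> \<rho> l z \<le> \<rho> l y"
        have "g l z = g l y"
          using \<rho>_le_iff[OF yX(1) zX l(1)] \<rho>_le_iff[OF zX xX l(1)] gt lt le geq_l by force
        then have "int (\<rho> h z) - int (\<rho> h y) = int (\<rho> l z) - int (\<rho> l y)"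
          by (rule \<rho>_shift[OF zX yX(1) l(1) h1(1)])
        then have "\<rho> h y < \<rho> h z" "\<rho> h z < m" using gt lt t by linarith+
        then show False using y_max[of z] z by (simp add: Y_def)
      qed
      then show "g l z < g l y \<or> g l z = g l y \<and> y \<le> z"
        using \<rho>_le_iff[OF zX yX(1) l(1)] by simp
    qed
  qed
  have "0 \<le> (\<Sum>l=1..h. \<delta> l y)" by (rule A[OF yX(2) h1(1)])
  also have "\<dots> \<le> (\<Sum>l=1..h. D l (n mod p ^ l))" by (intro sum_mono D_ge) auto
  also have "\<dots> \<le> (\<Sum>l=1..L. D l (n mod p ^ l))"
  proof (intro sum_mono2)
    fix l assume "l \<in> {1..L} - {1..h}"
    then have "l \<in> {1..L}" "l \<notin> S" using h(2)[of l] by auto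
    then show "0 \<le> D l (n mod p ^ l)" by (simp add: S_def not_less)
  qed (use h1 in auto)
  finally show ?thesis .
qed

lemma \<delta>_add_ord: "x \<in> X \<Longrightarrow> \<delta> (l + ord d a) x = \<delta> l x"
  unfolding \<delta>_def by (intro cnt_cong) (simp add: g_add_ord)

text \<open>The classes \<open>g l y\<close> depend only on \<open>l\<close> modulo
  \<open>ord d a\<close>.\<close>

lemma coarse_nonneg_of_period:
  assumes B: "\<And>l x. x \<in> X \<Longrightarrow> l \<in> {1..ord d a} \<Longrightarrow> cnt (\<lambda>y. g l y \<le> g l x) \<ge> 0"
    and x: "x \<in> X" and "l \<ge> 1"
  shows "cnt (\<lambda>y. g l y \<le> g l x) \<ge> 0"
  using \<open>l \<ge> 1\<close>
proof (induction l rule: less_induct)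
  case (less l)
  show ?case
  proof (cases "l \<le> ord d a")
    case True
    then show ?thesis using B[OF x, of l] less.prems by simp
  next
    case False
    define k where "k = l - ord d a"
    have k: "l = k + ord d a" "k \<ge> 1" "k < l" using False ord_pos by (auto simp: k_def)
    have "cnt (\<lambda>y. g l y \<le> g l x) = cnt (\<lambda>y. g k y \<le> g k x)"
      unfolding k(1) using x by (intro cnt_cong) (simp add: g_add_ord)
    then show ?thesis using less.IH[OF k(3,2)] by simp
  qed
qed

text \<open>An integral shift \<open>m\<close> leaves the class of the point unchanged and, being
  small enough, makes every tie count: whole clusters are counted.\<close>

lemma hg_delta_grid:
  assumes m: "m \<in> \<int>" "\<forall>y\<in>X. m \<le> real_of_rat y - frac1 (real_of_rat y)"
    and e: "e \<in> {1..d}"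
  shows "hg_delta \<alpha> \<beta> (real (a ^ l) * (real e / real d + m)) (a ^ l)
       = cnt (\<lambda>y. g l y \<le> frac1 (real (a ^ l) * (real e / real d)))"
  unfolding hg_delta_eq_cnt
proof (rule cnt_cong)
  fix y assume y: "y \<in> X"
  define F where "F = frac1 (real (a ^ l) * (real e / real d))"
  have F': "frac1 (real (a ^ l) * (real e / real d + m)) = F"
  proof -
    have "real (a ^ l) * m \<in> \<int>" using m(1) by (intro Ints_mult Ints_of_nat)
    then show ?thesis unfolding F_def by (intro frac1_cong) (simp add: algebra_simps)
  qed
  have ge: "real e / real d + m \<le> real_of_rat y" if "g l y = F"
  proof -
    have "real_of_rat y - real e / real d \<in> \<int>"
    proof (rule Ints_of_coprime_mult)
      have "real d * (real_of_rat y - real e / real d) = real d * real_of_rat y - real e"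
        using d_pos by (simp add: field_simps)
      then show "real d * (real_of_rat y - real e / real d) \<in> \<int>"
        using Ints_diff[OF real_d_Ints[OF y] Ints_of_nat] by simp
      show "real (a ^ l) * (real_of_rat y - real e / real d) \<in> \<int>"
        using frac1_eq_imp_diff_Ints[OF that[unfolded g_def F_def]]
        by (simp add: right_diff_distrib)
    qed
    \<comment> \<open>The range of \<open>e\<close> puts \<open>e / d\<close> into (0, 1].\<close>
    then have "frac1 (real_of_rat y) = real e / real d"
      using e d_pos by (intro frac1_eqI) auto
    then show ?thesis using bspec[OF m(2) y] by simp
  qed
  have "real (a ^ l) * real_of_rat y \<ge> real (a ^ l) * (real e / real d + m)" if "g l y = F"
    using ge[OF that] by (intro mult_left_mono) auto
  then show "real (a ^ l) * real_of_rat y \<preceq> real (a ^ l) * (real e / real d + m) \<longleftrightarrow>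
      g l y \<le> frac1 (real (a ^ l) * (real e / real d))"
    unfolding christol_le_def F' g_def[symmetric] F_def[symmetric] by auto
qed

lemma integral_iff_if_eq:
  assumes eq: "length \<alpha> = length \<beta>"
    and m: "m \<in> \<int>" "\<forall>y\<in>X. m \<le> real_of_rat y - frac1 (real_of_rat y)"
  shows "hypergeo_series \<alpha> \<beta> \<in> padic_int_fps p \<longleftrightarrow>
    (\<forall>h\<in>{1..ord d a}. \<forall>k<length \<beta>.
       (\<Sum>l=1..h. hg_delta \<alpha> \<beta> (real (a ^ l) * real_of_rat (\<beta> ! k)) (a ^ l)) \<ge> 0) \<and>
    (\<forall>l\<in>{1..ord d a}. \<forall>e\<in>{1..d}.
       hg_delta \<alpha> \<beta> (real (a ^ l) * (real e / real d + m)) (a ^ l) \<ge> 0)"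
    (is "?I \<longleftrightarrow> ?A \<and> ?B")
proof
  assume ?I
  then have V: "coeff_val n \<ge> 0" for n by (simp add: in_padic_int_fps_iff)
  have ?A
    unfolding hg_delta_pow using V by (intro ballI allI impI integral_imp_sum_\<delta>_nonneg[OF eq]) auto
  moreover have ?B
  proof (intro ballI)
    fix l e assume l: "l \<in> {1..ord d a}" and e: "e \<in> {1..d}"
    have "real d * (real (a ^ l) * (real e / real d)) = real (a ^ l * e)"
      using d_pos by simp
    then have "real d * (real (a ^ l) * (real e / real d)) \<in> \<int>" by (simp only: Ints_of_nat)
    then show "hg_delta \<alpha> \<beta> (real (a ^ l) * (real e / real d + m)) (a ^ l) \<ge> 0"
      unfolding hg_delta_grid[OF m e] using l frac1_props
      by (intro integral_imp_coarse_nonneg eq V mult_frac1_Ints) auto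
  qed
  ultimately show "?A \<and> ?B" ..
next
  assume AB: "?A \<and> ?B"
  have A: "(\<Sum>l=1..h. \<delta> l x) \<ge> 0" if x: "x \<in> set \<beta>" for h x
  proof (rule sum_periodic_nonneg[OF ord_pos])
    show "\<delta> (l + ord d a) x = \<delta> l x" for l using x by (intro \<delta>_add_ord) simp
    fix h assume "1 \<le> h" "h \<le> ord d a"
    then show "(\<Sum>l=1..h. \<delta> l x) \<ge> 0"
      using AB x unfolding hg_delta_pow by (auto simp: in_set_conv_nth)
  qed
  have B: "cnt (\<lambda>y. g l y \<le> g l x) \<ge> 0" if x: "x \<in> X" and l: "l \<in> {1..ord d a}" for l x
  proof -
    \<comment> \<open>The grid point with \<open>e = d * F\<close> has the class of
      \<open>x\<close>, so after multiplication by \<open>a ^ l\<close> its class is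
      \<open>g l x\<close>.\<close>
    define F where "F = frac1 (real_of_rat x)"
    have F: "0 < F" "F \<le> 1" "real_of_rat x - F \<in> \<int>" unfolding F_def by (rule frac1_props)+
    have "real d * F \<in> \<int>" unfolding F_def by (rule mult_frac1_Ints[OF real_d_Ints[OF x]])
    then obtain i where i: "real d * F = of_int i" by (auto elim: Ints_cases)
    have "real d * F > 0" "real d * F \<le> real d" using F d_pos by auto
    then have i_bounds: "0 < i" "i \<le> int d" unfolding i by linarith+
    have e: "nat i \<in> {1..d}" using i_bounds by auto
    have "F = real (nat i) / real d" using i i_bounds d_pos by (simp add: field_simps)
    moreover have "frac1 (real (a ^ l) * F) = g l x"
      unfolding g_def
    proof (rule frac1_cong)
      have "real (a ^ l) * (real_of_rat x - F) \<in> \<int>" using F(3) by (intro Ints_mult Ints_of_nat)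
      then have "- (real (a ^ l) * (real_of_rat x - F)) \<in> \<int>" by (rule Ints_minus)
      then show "real (a ^ l) * F - real (a ^ l) * real_of_rat x \<in> \<int>"
        by (simp add: right_diff_distrib)
    qed
    ultimately show ?thesis using AB l e hg_delta_grid[OF m e, of l] by fastforce
  qed
  have "coeff_val n \<ge> 0" for n
  proof -
    have "n \<le> p ^ n" using power_gt_expt[of p n] prime_gt_1_nat[OF prime_p] by simp
    then have "coeff_val n = (\<Sum>l=1..n. D l (n mod p ^ l))" using eq by (simp add: coeff_val_eq)
    then show ?thesis using sum_D_nonneg[OF A coarse_nonneg_of_period[OF B]] by simp
  qed
  then show ?I by (simp add: in_padic_int_fps_iff)
qed

end

theorem theorem1p2:
  fixes \<alpha> \<beta> :: "rat list" and r s d p a :: nat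
  defines "r \<equiv> length \<alpha>" and "s \<equiv> length \<beta>" and "d \<equiv> hg_denom \<alpha> \<beta>"
  assumes "r > 0" and "s > 0"
    and "\<forall>i<r. \<alpha> ! i \<notin> \<int>\<^sub>\<le>\<^sub>0" and "\<forall>j<s. \<beta> ! j \<notin> \<int>\<^sub>\<le>\<^sub>0"
    and "prime p" and "real p > max (hg_M \<alpha> \<beta>) (real (3 * s * d))"
    and "1 \<le> a" and "a \<le> d" and "[a * p = 1] (mod d)"
  shows "(r < s \<longrightarrow> hypergeo_series \<alpha> \<beta> \<notin> padic_int_fps p) \<and>
    (r > s \<longrightarrow>
      (hypergeo_series \<alpha> \<beta> \<in> padic_int_fps p \<longleftrightarrow> (\<forall>x::real. hg_delta \<alpha> \<beta> x a \<ge> 0))) \<and>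
    (r = s \<longrightarrow>
      (hypergeo_series \<alpha> \<beta> \<in> padic_int_fps p \<longleftrightarrow>
        (\<forall>h\<in>{1..ord d a}. \<forall>k<s.
           (\<Sum>l=1..h. hg_delta \<alpha> \<beta> (real (a ^ l) * real_of_rat (\<beta> ! k)) (a ^ l)) \<ge> 0) \<and>
        (\<forall>l\<in>{1..ord d a}. \<forall>e\<in>{1..d}.
           hg_delta \<alpha> \<beta> (real (a ^ l) * (real e / real d + hg_m \<alpha> \<beta>)) (a ^ l) \<ge> 0)))"
proof -
  define X where "X = set \<alpha> \<union> set \<beta>"
  define C where "C = Max ((\<lambda>x. \<bar>real_of_rat x\<bar>) ` X)"
  have X: "finite X" "X \<noteq> {}" using \<open>s > 0\<close> by (auto simp: X_def s_def)
  have C: "\<bar>real_of_rat x\<bar> \<le> C" if "x \<in> X" for x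
    unfolding C_def using X(1) that by (intro Max_ge) auto
  have "d > 0" using \<open>1 \<le> a\<close> \<open>a \<le> d\<close> by simp
  interpret christol_params \<alpha> \<beta> p d a C
  proof unfold_locales
    fix x assume x: "x \<in> set \<alpha> \<union> set \<beta>"
    show "\<bar>real_of_rat x\<bar> \<le> C" using C x by (simp add: X_def)
    show "x \<notin> \<int>\<^sub>\<le>\<^sub>0" using assms(6,7) x by (auto simp: in_set_conv_nth r_def s_def)
    obtain u v where uv: "quotient_of x = (u, v)" by fastforce
    have v: "v > 0" "x = of_int u / of_int v"
      using quotient_of_denom_pos[OF uv] quotient_of_div[OF uv] by auto
    have "nat (snd (quotient_of x)) dvd d"
      unfolding d_def hg_denom_def using x by (intro dvd_Lcm) auto
    then obtain w where "d = nat v * w" using uv by auto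
    then have "of_nat d * x = of_int (u * int w)" using v by simp
    then show "of_nat d * x \<in> \<int>" by (simp only: Ints_of_int)
  next
    obtain x where "x \<in> X" using X(2) by blast
    then show "C \<ge> 0" using C[of x] by linarith
    show "real p > real d * (2 + 2 * C)"
      using assms(9) by (simp add: hg_M_def C_def X_def d_def)
  qed (use assms \<open>d > 0\<close> in auto)
  \<comment> \<open>The minimum is attained by a parameter, hence is an integer.\<close>
  have "hg_m \<alpha> \<beta> \<in> (\<lambda>x. real_of_rat x - frac1 (real_of_rat x)) ` X"
    unfolding hg_m_def using X by (fold X_def, intro Min_in) auto
  then have m_int: "hg_m \<alpha> \<beta> \<in> \<int>" using frac1_props(3) by auto
  have m_le: "\<forall>y\<in>set \<alpha> \<union> set \<beta>. hg_m \<alpha> \<beta> \<le> real_of_rat y - frac1 (real_of_rat y)"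
    unfolding hg_m_def by (intro ballI Min_le) auto
  have p3: "p > 3 * length \<beta> * d" using assms(9) by (simp add: s_def del: of_nat_mult)
  have "hypergeo_series \<alpha> \<beta> \<in> padic_int_fps p \<longleftrightarrow> (\<forall>x. hg_delta \<alpha> \<beta> x a \<ge> 0)" if "r > s"
    unfolding in_padic_int_fps_iff D_1_nonneg_iff[symmetric]
    using integral_imp_D_1_nonneg greater_imp_coeff_val_nonneg p3 that \<open>s > 0\<close>
    unfolding r_def s_def by blast
  then show ?thesis
    using not_integral_if_less integral_iff_if_eq[OF _ m_int m_le]
    unfolding r_def s_def by blast
qed

end
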